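(* Let $F$ be a field, $n\ge 1$, and $A\in M_n(F)$. Then $A$ has an LU factorization if and only if Algorithm 1 (defined in the context), applied to $A$, produces an LU factorization of $A$, i.e. the output matrices $L,U\in M_n(F)$ of Algorithm 1 on input $A$ are respectively lower triangular and upper triangular and satisfy $A=LU$.
   Context: A matrix $A\in M_n(F)$ (an $n\times n$ matrix over $F$) has an LU factorization if there exist a lower triangular $L\in M_n(F)$ and an upper triangular $U\in M_n(F)$ with $A=LU$; $L$ and $U$ are not required to be invertible. Algorithm 1. Input: $A\in M_n(F)$. Set $A^{(1)}=A$. For $k=1,2,\ldots,n$ do the following with the current matrix $A^{(k)}=(a_{ij})$: (i) Search for a nonzero entry of $A^{(k)}$ in this order: for $i=1,\ldots,n$ and, for each $i$, for $j=i,\ldots,n$, first inspect position $(i,j)$, then position $(j,i)$. Let $(p,q)$ be the first inspected position with $a_{pq}\neq 0$, if there is one. (ii) If such a position $(p,q)$ exists, let the $k$-th column of $L$ be the $q$-th column of $A^{(k)}$, and let the $k$-th row of $U$ be $a_{pq}^{-1}$ times the $p$-th row of $A^{(k)}$. If $A^{(k)}=0$, let the $k$-th column of $L$ and the $k$-th row of $U$ both be zero. (iii) Put $A^{(k+1)}=A^{(k)}-(\text{$k$-th column of }L)(\text{$k$-th row of }U)$. Output: the $n\times n$ matrices $L$ and $U$. *)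

theory Defs
  imports "Jordan_Normal_Form.Matrix"
begin

text \<open>Rows and columns are indexed from 0, so every index (including the step counter of the
  algorithm) is one less than in the usual 1-based notation.\<close>

definition lower_triangular :: "'a::zero mat \<Rightarrow> bool" where
  "lower_triangular A \<longleftrightarrow> (\<forall>i < dim_row A. \<forall>j < dim_col A. i < j \<longrightarrow> A $$ (i, j) = 0)"

definition is_LU_factorization :: "nat \<Rightarrow> 'a::field mat \<Rightarrow> 'a mat \<Rightarrow> 'a mat \<Rightarrow> bool" where
  "is_LU_factorization n A L U \<longleftrightarrow>
     L \<in> carrier_mat n n \<and> U \<in> carrier_mat n n \<and>
     lower_triangular L \<and> upper_triangular U \<and> A = L * U"

definition has_LU_factorization :: "nat \<Rightarrow> 'a::field mat \<Rightarrow> bool" where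
  "has_LU_factorization n A \<longleftrightarrow> (\<exists>L U. is_LU_factorization n A L U)"

definition search_order :: "nat \<Rightarrow> (nat \<times> nat) list" where
  "search_order n = concat (map (\<lambda>i. concat (map (\<lambda>j. [(i, j), (j, i)]) [i..<n])) [0..<n])"

definition find_pivot :: "nat \<Rightarrow> 'a::zero mat \<Rightarrow> (nat \<times> nat) option" where
  "find_pivot n A = find (\<lambda>pos. A $$ pos \<noteq> 0) (search_order n)"

lemma set_search_order: "set (search_order n) = {0..<n} \<times> {0..<n}"
proof -
  have "(a, b) \<in> set (search_order n)" if "a < n" "b < n" for a b
    using that by (cases "a \<le> b") (force simp: search_order_def)+
  then show ?thesis by (auto simp: search_order_def)
qed

lemma find_pivot_None_iff:
  assumes "A \<in> carrier_mat n n"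
  shows "find_pivot n A = None \<longleftrightarrow> A = 0\<^sub>m n n"
  using assms by (auto simp: find_pivot_def find_None_iff set_search_order)

definition next_column_row :: "nat \<Rightarrow> 'a::field mat \<Rightarrow> 'a vec \<times> 'a vec" where
  "next_column_row n A =
     (case find_pivot n A of
        None \<Rightarrow> (0\<^sub>v n, 0\<^sub>v n)
      | Some (p, q) \<Rightarrow> (col A q, inverse (A $$ (p, q)) \<cdot>\<^sub>v row A p))"

definition eliminate :: "nat \<Rightarrow> 'a::field mat \<Rightarrow> 'a mat" where
  "eliminate n A = (case next_column_row n A of (c, r) \<Rightarrow> A - mat n n (\<lambda>(i, j). c $ i * r $ j))"

primrec residual :: "nat \<Rightarrow> 'a::field mat \<Rightarrow> nat \<Rightarrow> 'a mat" where
  "residual n A 0 = A"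
| "residual n A (Suc k) = eliminate n (residual n A k)"

definition LU_algorithm :: "nat \<Rightarrow> 'a::field mat \<Rightarrow> 'a mat \<times> 'a mat" where
  "LU_algorithm n A =
     (mat_of_cols n (map (\<lambda>k. fst (next_column_row n (residual n A k))) [0..<n]),
      mat_of_rows n (map (\<lambda>k. snd (next_column_row n (residual n A k))) [0..<n]))"

end

theory Submission
  imports Defs
begin

text \<open>Write \<open>r\<^sub>k\<^sub>n\<close>, \<open>r\<^sub>n\<^sub>k\<close>, \<open>r\<^sub>k\<^sub>k\<close> for the ranks of the first \<open>k\<close> rows, of the first \<open>k\<close> columns and of
  the leading \<open>k \<times> k\<close> block of a matrix. If \<open>A = L U\<close>, then Sylvester's inequality for the leading
  blocks of \<open>L\<close> and \<open>U\<close> yields \<open>r\<^sub>k\<^sub>n + r\<^sub>n\<^sub>k \<le> r\<^sub>k\<^sub>k + k\<close> for all \<open>k\<close>. The elimination step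
  improves this: after \<open>s\<close> steps, the residual satisfies \<open>r\<^sub>k\<^sub>n + r\<^sub>n\<^sub>k \<le> r\<^sub>k\<^sub>k + (k - s)\<close> with truncated
  subtraction. Indeed, the pivot lowers by one the rank of every block that contains it, while by the
  search order the step leaves the first \<open>k\<close> columns unchanged if \<open>p < k \<le> q\<close>, and the first
  \<open>k\<close> rows unchanged if \<open>q < k \<le> p\<close>. For \<open>k = s\<close> the inequality says that the first \<open>s\<close> rows and
  columns of the residual vanish, so the output matrices are triangular; for \<open>s = k = n\<close> it
  says that the last residual is zero, so \<open>A\<close> is their product.\<close>

section \<open>Rank\<close>

lemma sum_of_bool_left:
  fixes f :: "'b \<Rightarrow> 'a::field"
  assumes "finite K" "k \<in> K"
  shows "(\<Sum>s\<in>K. of_bool (s = k) * f s) = f k"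
proof -
  have "(\<Sum>s\<in>K. of_bool (s = k) * f s) = (\<Sum>s\<in>K. if s = k then f s else 0)"
    by (intro sum.cong) auto
  then show ?thesis using assms by (simp only: sum.delta if_True)
qed

lemma sum_of_bool_right:
  fixes f :: "'b \<Rightarrow> 'a::field"
  assumes "finite K" "k \<in> K"
  shows "(\<Sum>s\<in>K. f s * of_bool (s = k)) = f k"
  using sum_of_bool_left[OF assms, of f] by (simp only: mult.commute)

text \<open>Rank as the least number of outer products; for finite \<open>I\<close> this is the
  usual rank. Arbitrary index types allow deleted indices and disjoint sums without
  renumbering.\<close>

definition outer_rank :: "'i set \<Rightarrow> 'j set \<Rightarrow> ('i \<Rightarrow> 'j \<Rightarrow> 'a::field) \<Rightarrow> nat" where
  "outer_rank I J A = (LEAST r. \<exists>X Y. \<forall>i\<in>I. \<forall>j\<in>J. A i j = (\<Sum>t<r. X i t * Y t j))"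

lemma outer_rank_le_card:
  assumes "finite T" and "\<And>i j. i \<in> I \<Longrightarrow> j \<in> J \<Longrightarrow> A i j = (\<Sum>t\<in>T. X i t * Y t j)"
  shows "outer_rank I J A \<le> card T"
proof -
  obtain h where h: "bij_betw h {..<card T} T"
    using ex_bij_betw_nat_finite[OF assms(1)] by (auto simp: atLeast0LessThan)
  have "A i j = (\<Sum>t<card T. X i (h t) * Y (h t) j)" if "i \<in> I" "j \<in> J" for i j
    using assms(2)[OF that] sum.reindex_bij_betw[OF h, of "\<lambda>t. X i t * Y t j"] by simp
  then show ?thesis
    unfolding outer_rank_def
    by (intro Least_le exI[of _ "\<lambda>i t. X i (h t)"] exI[of _ "\<lambda>t. Y (h t)"]) auto
qed

text \<open>The least number is attained: for finite \<open>I\<close>, the identity times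
  \<open>A\<close> is an admissible factorization.\<close>

lemma outer_rank_factorization:
  assumes "finite I"
  obtains X Y where "\<And>i j. i \<in> I \<Longrightarrow> j \<in> J \<Longrightarrow> A i j = (\<Sum>t<outer_rank I J A. X i t * Y t j)"
proof -
  obtain h where h: "bij_betw h {..<card I} I"
    using ex_bij_betw_nat_finite[OF assms(1)] by (auto simp: atLeast0LessThan)
  have delta: "A i j = (\<Sum>t<card I. of_bool (h t = i) * A (h t) j)" if "i \<in> I" for i j
    using sum.reindex_bij_betw[OF h, of "\<lambda>k. of_bool (k = i) * A k j"]
      sum_of_bool_left[OF assms that, of "\<lambda>k. A k j"] by (simp only:)
  have "\<exists>(r::nat) X Y. \<forall>i\<in>I. \<forall>j\<in>J. A i j = (\<Sum>t<r. X i t * Y t j)"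
    by (rule exI[of _ "card I"], rule exI[of _ "\<lambda>i t. of_bool (h t = i)"],
        rule exI[of _ "\<lambda>t. A (h t)"], intro ballI, rule delta)
  from LeastI_ex[OF this] show ?thesis
    unfolding outer_rank_def[symmetric] using that by blast
qed

lemma outer_rank_cong:
  assumes "\<And>i j. i \<in> I \<Longrightarrow> j \<in> J \<Longrightarrow> A i j = B i j"
  shows "outer_rank I J A = outer_rank I J B"
  unfolding outer_rank_def using assms by (simp cong: ball_cong)

lemma outer_rank_mono:
  assumes "finite I'" "I \<subseteq> I'" "J \<subseteq> J'"
  shows "outer_rank I J A \<le> outer_rank I' J' A"
proof -
  obtain X Y where "\<And>i j. i \<in> I' \<Longrightarrow> j \<in> J' \<Longrightarrow> A i j = (\<Sum>t<outer_rank I' J' A. X i t * Y t j)"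
    using outer_rank_factorization[OF assms(1)] by metis
  then have "outer_rank I J A \<le> card {..<outer_rank I' J' A}"
    using assms by (intro outer_rank_le_card[of _ _ _ _ X Y]) auto
  then show ?thesis by simp
qed

lemma outer_rank_eq_0_iff:
  assumes "finite I"
  shows "outer_rank I J A = 0 \<longleftrightarrow> (\<forall>i\<in>I. \<forall>j\<in>J. A i j = 0)"
proof
  assume 0: "outer_rank I J A = 0"
  obtain X Y where "\<And>i j. i \<in> I \<Longrightarrow> j \<in> J \<Longrightarrow> A i j = (\<Sum>t<outer_rank I J A. X i t * Y t j)"
    using outer_rank_factorization[OF assms(1)] by metis
  with 0 show "\<forall>i\<in>I. \<forall>j\<in>J. A i j = 0" by simp
next
  assume "\<forall>i\<in>I. \<forall>j\<in>J. A i j = 0"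
  then show "outer_rank I J A = 0"
    using outer_rank_le_card[of "{}::nat set" I J A] by simp
qed

text \<open>A rank factorization of \<open>L\<close> absorbs \<open>U\<close> into its second
  factor.\<close>

lemma outer_rank_product_le_left:
  assumes "finite I" and A: "\<And>i j. i \<in> I \<Longrightarrow> j \<in> J \<Longrightarrow> A i j = (\<Sum>t\<in>K. L i t * U t j)"
  shows "outer_rank I J A \<le> outer_rank I K L"
proof -
  let ?r = "outer_rank I K L"
  obtain X Y where XY: "\<And>i t. i \<in> I \<Longrightarrow> t \<in> K \<Longrightarrow> L i t = (\<Sum>s<?r. X i s * Y s t)"
    using outer_rank_factorization[OF assms(1)] by metis
  have "A i j = (\<Sum>s<?r. X i s * (\<Sum>t\<in>K. Y s t * U t j))" if "i \<in> I" "j \<in> J" for i j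
  proof -
    have "A i j = (\<Sum>t\<in>K. \<Sum>s<?r. X i s * Y s t * U t j)"
      using that by (simp add: A XY sum_distrib_right)
    also have "\<dots> = (\<Sum>s<?r. \<Sum>t\<in>K. X i s * Y s t * U t j)"
      by (rule sum.swap)
    finally show ?thesis by (simp add: sum_distrib_left mult.assoc)
  qed
  then have "outer_rank I J A \<le> card {..<?r}"
    by (intro outer_rank_le_card[of _ _ _ _ X]) auto
  then show ?thesis by simp
qed

lemma outer_rank_product_le_right:
  assumes "finite K" and A: "\<And>i j. i \<in> I \<Longrightarrow> j \<in> J \<Longrightarrow> A i j = (\<Sum>t\<in>K. L i t * U t j)"
  shows "outer_rank I J A \<le> outer_rank K J U"
proof -
  let ?r = "outer_rank K J U"
  obtain X Y where XY: "\<And>t j. t \<in> K \<Longrightarrow> j \<in> J \<Longrightarrow> U t j = (\<Sum>s<?r. X t s * Y s j)"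
    using outer_rank_factorization[OF assms(1)] by metis
  have "A i j = (\<Sum>s<?r. (\<Sum>t\<in>K. L i t * X t s) * Y s j)" if "i \<in> I" "j \<in> J" for i j
  proof -
    have "A i j = (\<Sum>t\<in>K. \<Sum>s<?r. L i t * X t s * Y s j)"
      using that by (simp add: A XY sum_distrib_left mult.assoc)
    also have "\<dots> = (\<Sum>s<?r. \<Sum>t\<in>K. L i t * X t s * Y s j)"
      by (rule sum.swap)
    finally show ?thesis by (simp add: sum_distrib_right)
  qed
  then have "outer_rank I J A \<le> card {..<?r}"
    by (intro outer_rank_le_card[of _ _ _ _ _ Y]) auto
  then show ?thesis by simp
qed

section \<open>Rank-one changes and Sylvester's inequality\<close>

lemma outer_rank_le_Suc_diff:
  assumes "finite I"
  shows "outer_rank I J A \<le> Suc (outer_rank I J (\<lambda>i j. A i j - c i * d j))"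
proof -
  let ?r = "outer_rank I J (\<lambda>i j. A i j - c i * d j)"
  obtain X Y where XY: "\<And>i j. i \<in> I \<Longrightarrow> j \<in> J \<Longrightarrow> A i j - c i * d j = (\<Sum>t<?r. X i t * Y t j)"
    by (rule outer_rank_factorization[OF assms, of J "\<lambda>i j. A i j - c i * d j"]) (rule that)
  have "A i j = (\<Sum>t<Suc ?r. (if t = ?r then c i else X i t) * (if t = ?r then d j else Y t j))"
    if "i \<in> I" "j \<in> J" for i j
    using XY[OF that] by (simp add: algebra_simps)
  then have "outer_rank I J A \<le> card {..<Suc ?r}"
    by (intro outer_rank_le_card[of _ _ _ _ "\<lambda>i t. if t = ?r then c i else X i t"
          "\<lambda>t j. if t = ?r then d j else Y t j"]) auto
  then show ?thesis by simp
qed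

text \<open>The rows of the second factor satisfy a linear relation, by which one of them is
  eliminated.\<close>

lemma sum_outer_eliminate_row:
  fixes y :: "'b \<Rightarrow> 'a::field"
  assumes "finite T" "t \<in> T" "y t \<noteq> 0" and rel: "(\<Sum>s\<in>T. y s * Y s j) = 0"
  shows "(\<Sum>s\<in>T. X i s * Y s j) = (\<Sum>s\<in>T - {t}. (X i s - X i t * inverse (y t) * y s) * Y s j)"
proof -
  have "y t * Y t j = - (\<Sum>s\<in>T - {t}. y s * Y s j)"
    using rel sum.remove[OF assms(1,2), of "\<lambda>s. y s * Y s j"] by (simp add: eq_neg_iff_add_eq_0)
  then have "Y t j = inverse (y t) * - (\<Sum>s\<in>T - {t}. y s * Y s j)"
    using assms(3) by (simp add: field_simps)
  then have "X i t * Y t j = - (\<Sum>s\<in>T - {t}. X i t * inverse (y t) * y s * Y s j)"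
    by (simp add: sum_distrib_left mult.assoc)
  then show ?thesis
    by (subst sum.remove[OF assms(1,2)]) (simp add: left_diff_distrib sum_subtractf)
qed

text \<open>Wedderburn's rank reduction: subtracting the pivot term changes only the second factor
  of a rank factorization. Row \<open>p\<close> of the result vanishes, and this linear relation
  saves one term.\<close>

lemma Suc_outer_rank_pivot_le:
  assumes "finite I" "p \<in> I" "q \<in> J" "A p q \<noteq> 0"
  shows "Suc (outer_rank I J (\<lambda>i j. A i j - A i q * (inverse (A p q) * A p j))) \<le> outer_rank I J A"
proof -
  let ?r = "outer_rank I J A" and ?a = "inverse (A p q)"
  obtain X Y where XY: "\<And>i j. i \<in> I \<Longrightarrow> j \<in> J \<Longrightarrow> A i j = (\<Sum>t<?r. X i t * Y t j)"
    using outer_rank_factorization[OF assms(1)] by metis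
  have "\<exists>t<?r. X p t \<noteq> 0"
    using assms XY[of p q] by (metis (no_types, lifting) lessThan_iff mult_zero_left sum.neutral)
  then obtain t where t: "t < ?r" "X p t \<noteq> 0" by blast
  define Z where "Z s j = Y s j - Y s q * (?a * A p j)" for s j
  \<comment> \<open>Column \<open>q\<close> of \<open>X Y\<close> is column \<open>q\<close> of
    \<open>A\<close>, so \<open>X Z\<close> is the reduced matrix.\<close>
  have Z: "(\<Sum>s<?r. X i s * Z s j) = A i j - A i q * (?a * A p j)" if "i \<in> I" "j \<in> J" for i j
    using that assms(3)
    by (simp add: XY[of i] Z_def right_diff_distrib sum_subtractf sum_distrib_right mult.assoc)
  have rel: "(\<Sum>s<?r. X p s * Z s j) = 0" if "j \<in> J" for j
    using Z[of p j] that assms by simp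
  have "A i j - A i q * (?a * A p j)
      = (\<Sum>s\<in>{..<?r} - {t}. (X i s - X i t * inverse (X p t) * X p s) * Z s j)"
    if "i \<in> I" "j \<in> J" for i j
    using sum_outer_eliminate_row[of "{..<?r}" t "X p" Z j X i] rel[OF that(2)] t Z[OF that] by simp
  then have "outer_rank I J (\<lambda>i j. A i j - A i q * (?a * A p j)) \<le> card ({..<?r} - {t})"
    by (intro outer_rank_le_card[of _ _ _ _ "\<lambda>i s. X i s - X i t * inverse (X p t) * X p s" Z]) auto
  then show ?thesis using t by simp
qed

text \<open>Induction on the inner dimension: a nonzero entry \<open>L p t\<close> expresses row
  \<open>t\<close> of \<open>U\<close> by its other rows. Clearing column \<open>t\<close> of
  \<open>L\<close> with row \<open>p\<close> and deleting index \<open>t\<close> then costs at most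
  one in the rank of \<open>L\<close> and nothing in that of \<open>U\<close>.\<close>

lemma outer_rank_product_zero:
  fixes L :: "'a \<Rightarrow> 'b \<Rightarrow> 'c::field"
  assumes "finite K" "finite I"
    and "\<And>i j. i \<in> I \<Longrightarrow> j \<in> J \<Longrightarrow> (\<Sum>t\<in>K. L i t * U t j) = 0"
  shows "outer_rank I K L + outer_rank K J U \<le> card K"
  using assms
proof (induction "card K" arbitrary: K L)
  case 0
  then show ?case by (simp add: outer_rank_eq_0_iff)
next
  case (Suc k)
  show ?case
  proof (cases "\<exists>p\<in>I. \<exists>t\<in>K. L p t \<noteq> 0")
    case False
    then have "outer_rank I K L = 0" using Suc.prems by (simp add: outer_rank_eq_0_iff)
    moreover have "outer_rank K J U \<le> card K"
      by (rule outer_rank_le_card[OF Suc.prems(1) sum_of_bool_left[OF Suc.prems(1), symmetric]])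
    ultimately show ?thesis by simp
  next
    case True
    then obtain p t where pt: "p \<in> I" "t \<in> K" "L p t \<noteq> 0" by blast
    let ?K = "K - {t}"
    let ?L = "\<lambda>i s. L i s - L i t * (inverse (L p t) * L p s)"
    \<comment> \<open>\<open>X\<close> has its own type of row indices because it is taken to be
      \<open>L\<close> first and the identity on \<open>K\<close> later.\<close>
    have elim: "(\<Sum>s\<in>K. X i s * U s j)
        = (\<Sum>s\<in>?K. (X i s - X i t * inverse (L p t) * L p s) * U s j)"
      if "j \<in> J" for X :: "'x \<Rightarrow> 'b \<Rightarrow> 'c" and i j
      using Suc.prems pt that by (intro sum_outer_eliminate_row) auto
    have "outer_rank I ?K ?L + outer_rank ?K J U \<le> card ?K"
    proof (rule Suc.hyps(1))
      show "k = card ?K" using Suc.hyps(2) pt by simp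
      show "(\<Sum>s\<in>?K. ?L i s * U s j) = 0" if "i \<in> I" "j \<in> J" for i j
        using elim[OF that(2), of L i] Suc.prems(3)[OF that] by (simp add: mult.assoc)
    qed (use Suc.prems in auto)
    moreover have "outer_rank I K L \<le> Suc (outer_rank I K ?L)"
      using Suc.prems(2) by (rule outer_rank_le_Suc_diff)
    \<comment> \<open>Column \<open>t\<close> of \<open>?L\<close> vanishes, so its deletion does
      not lower the rank.\<close>
    moreover have "outer_rank I K ?L \<le> outer_rank I ?K ?L"
    proof (rule outer_rank_product_le_left[where U = "\<lambda>s k. of_bool (s = k)"])
      fix i k assume "i \<in> I" "k \<in> K"
      show "?L i k = (\<Sum>s\<in>?K. ?L i s * of_bool (s = k))"
      proof (cases "k = t")
        case True
        have "(\<Sum>s\<in>?K. ?L i s * of_bool (s = k)) = 0" using True by (intro sum.neutral) auto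
        then show ?thesis using True pt(3) by simp
      next
        case False
        then show ?thesis
          using sum_of_bool_right[of ?K k "?L i"] \<open>k \<in> K\<close> Suc.prems(1) by simp
      qed
    qed (use Suc.prems in auto)
    \<comment> \<open>With the identity for \<open>X\<close>, \<open>elim\<close> writes every row
      of \<open>U\<close>, row \<open>t\<close> included, through the remaining rows.\<close>
    moreover have "outer_rank K J U \<le> outer_rank ?K J U"
    proof (rule outer_rank_product_le_right)
      fix i j assume "i \<in> K" "j \<in> J"
      have "U i j = (\<Sum>s\<in>K. of_bool (s = i) * U s j)"
        using sum_of_bool_left[OF Suc.prems(1) \<open>i \<in> K\<close>] by (rule sym)
      also have "\<dots> = (\<Sum>s\<in>?K. (of_bool (s = i) - of_bool (t = i) * inverse (L p t) * L p s) * U s j)"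
        using \<open>j \<in> J\<close> by (rule elim)
      finally show "U i j = (\<Sum>s\<in>?K. (of_bool (s = i) - of_bool (t = i) * inverse (L p t) * L p s) * U s j)" .
    qed (use Suc.prems in auto)
    moreover have "card K = Suc (card ?K)" using Suc.hyps(2) pt by simp
    ultimately show ?thesis by linarith
  qed
qed

text \<open>A rank factorization \<open>X Y\<close> of \<open>L U\<close> makes the product of \<open>(L, -X)\<close> and the
  stack of \<open>U\<close> and \<open>Y\<close> vanish.\<close>

lemma sylvester_outer_rank:
  assumes "finite K" "finite I" and A: "\<And>i j. i \<in> I \<Longrightarrow> j \<in> J \<Longrightarrow> A i j = (\<Sum>t\<in>K. L i t * U t j)"
  shows "outer_rank I K L + outer_rank K J U \<le> outer_rank I J A + card K"
proof -
  let ?r = "outer_rank I J A"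
  obtain X Y where XY: "\<And>i j. i \<in> I \<Longrightarrow> j \<in> J \<Longrightarrow> A i j = (\<Sum>t<?r. X i t * Y t j)"
    using outer_rank_factorization[OF assms(2)] by metis
  let ?T = "K <+> {..<?r}"
  let ?L = "\<lambda>i. case_sum (L i) (\<lambda>t. - X i t)" and ?U = "\<lambda>t j. case_sum (\<lambda>t. U t j) (\<lambda>t. Y t j) t"
  have "outer_rank I ?T ?L + outer_rank ?T J ?U \<le> card ?T"
  proof (rule outer_rank_product_zero)
    show "(\<Sum>t\<in>?T. ?L i t * ?U t j) = 0" if "i \<in> I" "j \<in> J" for i j
      using that assms(1) A[OF that] XY[OF that] by (simp add: sum.Plus sum_negf)
  qed (use assms in auto)
  moreover have "card ?T = ?r + card K" using assms(1) by (simp add: card_Plus)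
  \<comment> \<open>The matrix \<open>of_bool (s = Inl k)\<close> selects the summand
    \<open>K\<close> of the disjoint sum.\<close>
  moreover have "outer_rank I K L \<le> outer_rank I ?T ?L"
  proof (rule outer_rank_product_le_left[where U = "\<lambda>s k. of_bool (s = Inl k)"])
    fix i k assume "i \<in> I" "k \<in> K"
    then show "L i k = (\<Sum>s\<in>?T. ?L i s * of_bool (s = Inl k))"
      by (subst sum_of_bool_right) (auto simp: assms(1))
  qed (use assms in auto)
  moreover have "outer_rank K J U \<le> outer_rank ?T J ?U"
  proof (rule outer_rank_product_le_right[where L = "\<lambda>k s. of_bool (s = Inl k)"])
    fix k j assume "k \<in> K" "j \<in> J"
    then show "U k j = (\<Sum>s\<in>?T. of_bool (s = Inl k) * ?U s j)"
      by (subst sum_of_bool_left) (auto simp: assms(1))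
  qed (use assms in auto)
  ultimately show ?thesis by linarith
qed

section \<open>Pivot search\<close>

lemma find_sorted_Some_minimal:
  assumes "sorted (map f xs)" "find P xs = Some x" "y \<in> set xs" "P y"
  shows "f x \<le> f y"
  using assms by (induction xs) (auto split: if_splits)

text \<open>The search runs lexicographically through the pairs of minimum and maximum; as the
  maximum is below \<open>n\<close>, base \<open>n\<close> encodes such a pair in one number.
  Mirrored positions share their key.\<close>

lemma sorted_map_search_order:
  "sorted (map (\<lambda>(i, j). min i j * n + max i j) (search_order n))"
proof -
  let ?f = "\<lambda>(i, j). min i j * n + max i j"
  let ?row = "\<lambda>i m. concat (map (\<lambda>j. [(i, j), (j, i)]) [i..<m])"
  \<comment> \<open>The list bound \<open>m\<close> grows in the induction while the base
    \<open>n\<close> of the key stays fixed.\<close>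
  have row: "sorted (map ?f (?row i m))" for i m
  proof (induction m)
    case (Suc m)
    then show ?case by (auto simp: sorted_append)
  qed simp
  have "sorted (map ?f (concat (map (\<lambda>i. ?row i n) [0..<m])))" for m
  proof (induction m)
    case (Suc m)
    have "i * n + j \<le> m * n + j'" if "i < m" "j < n" for i j j'
    proof -
      have "i * n + n \<le> m * n" using that(1)
        by (metis Suc_leI add.commute mult_Suc mult_le_mono1)
      then show ?thesis using that(2) by linarith
    qed
    then show ?case using Suc row[of m n] by (auto simp: sorted_append)
  qed simp
  then show ?thesis by (simp add: search_order_def)
qed

text \<open>Positions with a smaller key were inspected before the pivot. The mirror position
  \<open>(q, p)\<close> has an equal key, so nothing is claimed about it.\<close>

lemma find_pivot_SomeD:
  assumes "find_pivot n A = Some (p, q)"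
  shows "p < n" "q < n" "A $$ (p, q) \<noteq> 0"
    and "\<And>i j. \<lbrakk>i < n; j < n; min i j < min p q\<rbrakk> \<Longrightarrow> A $$ (i, j) = 0"
    and "\<And>i j. \<lbrakk>i < n; j < n; min i j = min p q; max i j < max p q\<rbrakk> \<Longrightarrow> A $$ (i, j) = 0"
proof -
  have "(p, q) \<in> set (search_order n) \<and> A $$ (p, q) \<noteq> 0"
    using assms by (auto simp: find_pivot_def find_Some_iff)
  then show pq: "p < n" "q < n" "A $$ (p, q) \<noteq> 0" by (auto simp: set_search_order)
  have minimal: "min p q * n + max p q \<le> min i j * n + max i j"
    if "i < n" "j < n" "A $$ (i, j) \<noteq> 0" for i j
    using find_sorted_Some_minimal[OF sorted_map_search_order assms[unfolded find_pivot_def], of "(i, j)"]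
      that by (simp add: set_search_order)
  show "A $$ (i, j) = 0" if "i < n" "j < n" "min i j < min p q" for i j
  proof (rule ccontr)
    assume "A $$ (i, j) \<noteq> 0"
    from minimal[OF that(1,2) this] have "min p q * n + max p q \<le> min i j * n + max i j" .
    moreover have "min i j * n + n \<le> min p q * n"
      using that(3) by (metis Suc_leI add.commute mult_Suc mult_le_mono1)
    moreover have "max i j < n" using that by simp
    ultimately show False by linarith
  qed
  show "A $$ (i, j) = 0" if "i < n" "j < n" "min i j = min p q" "max i j < max p q" for i j
    using minimal[OF that(1,2)] that(3,4) by fastforce
qed

section \<open>The invariant of the elimination\<close>

definition leading_rank :: "nat \<Rightarrow> nat \<Rightarrow> 'a::field mat \<Rightarrow> nat" where
  "leading_rank k l A = outer_rank {..<k} {..<l} (\<lambda>i j. A $$ (i, j))"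

definition rank_condition :: "nat \<Rightarrow> nat \<Rightarrow> 'a::field mat \<Rightarrow> bool" where
  "rank_condition n s A \<longleftrightarrow>
     (\<forall>k\<le>n. leading_rank k n A + leading_rank n k A \<le> leading_rank k k A + (k - s))"

lemma leading_rank_eq_0_iff:
  "leading_rank k l A = 0 \<longleftrightarrow> (\<forall>i<k. \<forall>j<l. A $$ (i, j) = 0)"
  by (auto simp: leading_rank_def outer_rank_eq_0_iff)

lemma leading_rank_mono: "k \<le> k' \<Longrightarrow> l \<le> l' \<Longrightarrow> leading_rank k l A \<le> leading_rank k' l' A"
  unfolding leading_rank_def by (intro outer_rank_mono) auto

lemma leading_rank_cong:
  "(\<And>i j. i < k \<Longrightarrow> j < l \<Longrightarrow> A $$ (i, j) = B $$ (i, j)) \<Longrightarrow> leading_rank k l A = leading_rank k l B"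
  unfolding leading_rank_def by (intro outer_rank_cong) auto

text \<open>For \<open>k\<close> at most \<open>s\<close> the slack is zero, and the rank of the
  leading block is bounded by each of the two ranks on the left, so both are zero.\<close>

lemma rank_condition_zero:
  assumes "rank_condition n s A" "k \<le> n" "k \<le> s" "i < n" "j < n" "min i j < k"
  shows "A $$ (i, j) = 0"
proof -
  have "leading_rank k n A + leading_rank n k A \<le> leading_rank k k A"
    using assms by (auto simp: rank_condition_def dest!: spec[of _ k])
  moreover have "leading_rank k k A \<le> leading_rank k n A" "leading_rank k k A \<le> leading_rank n k A"
    using assms by (auto intro: leading_rank_mono)
  ultimately have "leading_rank k n A = 0" "leading_rank n k A = 0" by linarith+
  then show ?thesis using assms by (auto simp: leading_rank_eq_0_iff min_less_iff_disj)
qed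

section \<open>Effect of one elimination step\<close>

lemma eliminate_carrier [simp]: "A \<in> carrier_mat n n \<Longrightarrow> eliminate n A \<in> carrier_mat n n"
  by (auto simp: eliminate_def split: prod.split)

lemma residual_carrier [simp]: "A \<in> carrier_mat n n \<Longrightarrow> residual n A k \<in> carrier_mat n n"
  by (induction k) auto

lemma eliminate_index:
  assumes "i < n" "j < n"
  shows "eliminate n A $$ (i, j)
    = A $$ (i, j) - fst (next_column_row n A) $ i * snd (next_column_row n A) $ j"
  using assms by (simp add: eliminate_def split: prod.split)

lemma eliminate_pivot_index:
  assumes "A \<in> carrier_mat n n" "find_pivot n A = Some (p, q)" "i < n" "j < n"
  shows "eliminate n A $$ (i, j)
    = A $$ (i, j) - A $$ (i, q) * (inverse (A $$ (p, q)) * A $$ (p, j))"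
  using assms find_pivot_SomeD(1,2)[OF assms(2)]
  by (auto simp: eliminate_index next_column_row_def)

lemma leading_rank_eliminate:
  assumes "A \<in> carrier_mat n n" "find_pivot n A = Some (p, q)" "k \<le> n" "l \<le> n"
  shows "leading_rank k l A \<le> Suc (leading_rank k l (eliminate n A))"
    and "p < k \<Longrightarrow> q < l \<Longrightarrow> Suc (leading_rank k l (eliminate n A)) \<le> leading_rank k l A"
proof -
  let ?B = "\<lambda>i j. A $$ (i, j) - A $$ (i, q) * (inverse (A $$ (p, q)) * A $$ (p, j))"
  have *: "leading_rank k l (eliminate n A) = outer_rank {..<k} {..<l} ?B"
    using assms unfolding leading_rank_def
    by (intro outer_rank_cong eliminate_pivot_index) auto
  show "leading_rank k l A \<le> Suc (leading_rank k l (eliminate n A))"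
    unfolding * unfolding leading_rank_def by (rule outer_rank_le_Suc_diff) simp
  show "Suc (leading_rank k l (eliminate n A)) \<le> leading_rank k l A" if "p < k" "q < l"
    unfolding * unfolding leading_rank_def using that find_pivot_SomeD(3)[OF assms(2)]
    by (intro Suc_outer_rank_pivot_le) auto
qed

lemma rank_condition_eliminate:
  assumes A: "A \<in> carrier_mat n n" and cond: "rank_condition n s A"
  shows "rank_condition n (Suc s) (eliminate n A)"
proof (cases "find_pivot n A")
  case None
  then have "A $$ (i, j) = 0" if "i < n" "j < n" for i j
    using that A by (simp add: find_pivot_None_iff)
  then have "eliminate n A $$ (i, j) = 0" if "i < n" "j < n" for i j
    using that None by (simp add: eliminate_index next_column_row_def)
  then have "leading_rank k l (eliminate n A) = 0" if "k \<le> n" "l \<le> n" for k l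
    using that by (auto simp: leading_rank_eq_0_iff)
  then show ?thesis by (simp add: rank_condition_def)
next
  case (Some pq)
  then obtain p q where piv: "find_pivot n A = Some (p, q)" by (cases pq) auto
  note pivD = find_pivot_SomeD[OF piv]
  let ?B = "eliminate n A"
  note B = eliminate_pivot_index[OF A piv]
  show ?thesis unfolding rank_condition_def
  proof (intro allI impI)
    fix k assume k: "k \<le> n"
    show "leading_rank k n ?B + leading_rank n k ?B \<le> leading_rank k k ?B + (k - Suc s)"
    proof (cases "k \<le> min p q")
      case True
      \<comment> \<open>The first \<open>k\<close> rows and columns were searched without success
        before the pivot; the step keeps them zero.\<close>
      have "A $$ (i, j) = 0" if "i < n" "j < n" "min i j < k" for i j
        using pivD(4)[of i j] that True by simp
      then have "?B $$ (i, j) = 0" if "i < n" "j < n" "min i j < k" for i j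
        using that pivD(1,2) by (auto simp: B min_less_iff_disj)
      then have "leading_rank k n ?B = 0" "leading_rank n k ?B = 0"
        using k by (auto simp: leading_rank_eq_0_iff)
      then show ?thesis by simp
    next
      case False
      \<comment> \<open>Otherwise the condition on \<open>A\<close> would force the pivot entry to
        be zero. Hence \<open>k - Suc s\<close> is truly one less than \<open>k - s\<close>.\<close>
      have sk: "s < k"
        using rank_condition_zero[OF cond k, of p q] pivD(1-3) False by force
      have cond_k: "leading_rank k n A + leading_rank n k A \<le> leading_rank k k A + (k - s)"
        using cond k by (simp add: rank_condition_def)
      note step = leading_rank_eliminate[OF A piv]
      consider "p < k" "q < k" | "p < k" "k \<le> q" | "q < k" "k \<le> p" using False by linarith
      then show ?thesis
      proof cases
        case 1
        \<comment> \<open>The pivot lies in all three blocks: the left side falls by at least two,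
          the right side by at most two.\<close>
        have "leading_rank k k A \<le> Suc (leading_rank k k ?B)"
          "Suc (leading_rank k n ?B) \<le> leading_rank k n A"
          "Suc (leading_rank n k ?B) \<le> leading_rank n k A"
          using step k 1 pivD by auto
        then show ?thesis using cond_k sk by linarith
      next
        case 2
        \<comment> \<open>These positions precede the pivot: for \<open>j < p\<close> in an earlier
          round, otherwise in the same round before column \<open>q\<close>. So the step leaves the
          first \<open>k\<close> columns unchanged.\<close>
        have "A $$ (p, j) = 0" if "j < k" for j
          using pivD(4,5)[of p j] pivD(1) that 2 k by (cases "j < p") (auto simp: min_def max_def)
        then have "?B $$ (i, j) = A $$ (i, j)" if "i < n" "j < k" for i j
          using that k by (simp add: B)
        then have "leading_rank n k ?B = leading_rank n k A" "leading_rank k k ?B = leading_rank k k A"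
          using k by (auto intro!: leading_rank_cong)
        moreover have "Suc (leading_rank k n ?B) \<le> leading_rank k n A"
          using step k 2 pivD by auto
        ultimately show ?thesis using cond_k sk by linarith
      next
        case 3
        \<comment> \<open>The mirror image: the first \<open>k\<close> rows are unchanged.\<close>
        have "A $$ (i, q) = 0" if "i < k" for i
          using pivD(4,5)[of i q] pivD(2) that 3 k by (cases "i < q") (auto simp: min_def max_def)
        then have "?B $$ (i, j) = A $$ (i, j)" if "i < k" "j < n" for i j
          using that k by (simp add: B)
        then have "leading_rank k n ?B = leading_rank k n A" "leading_rank k k ?B = leading_rank k k A"
          using k by (auto intro!: leading_rank_cong)
        moreover have "Suc (leading_rank n k ?B) \<le> leading_rank n k A"
          using step k 3 pivD by auto
        ultimately show ?thesis using cond_k sk by linarith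
      qed
    qed
  qed
qed

section \<open>The rank condition for a matrix with an LU factorization\<close>

lemma rank_condition_LU:
  assumes "is_LU_factorization n A L U"
  shows "rank_condition n 0 A"
  unfolding rank_condition_def
proof (intro allI impI)
  fix k assume k: "k \<le> n"
  have L: "L \<in> carrier_mat n n" and U: "U \<in> carrier_mat n n" and AL: "A = L * U"
    and L0: "\<And>i t. i < n \<Longrightarrow> t < n \<Longrightarrow> i < t \<Longrightarrow> L $$ (i, t) = 0"
    and U0: "\<And>t j. t < n \<Longrightarrow> j < t \<Longrightarrow> U $$ (t, j) = 0"
    using assms by (auto simp: is_LU_factorization_def lower_triangular_def upper_triangular_def)
  let ?l = "\<lambda>i t. L $$ (i, t)" and ?u = "\<lambda>t j. U $$ (t, j)"
  \<comment> \<open>Inner indices from \<open>k\<close> on drop out: \<open>L\<close> vanishes there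
    if \<open>i < k\<close>, and \<open>U\<close> if \<open>j < k\<close>.\<close>
  have A: "A $$ (i, j) = (\<Sum>t<k. ?l i t * ?u t j)" if "i < n" "j < n" "min i j < k" for i j
  proof -
    have "A $$ (i, j) = (\<Sum>t<n. ?l i t * ?u t j)"
      using that L U by (simp add: AL scalar_prod_def atLeast0LessThan)
    also have "\<dots> = (\<Sum>t<k. ?l i t * ?u t j)"
      using that k L0 U0 by (intro sum.mono_neutral_right) (auto simp: min_less_iff_disj)
    finally show ?thesis .
  qed
  have "leading_rank k n A \<le> outer_rank {..<k} {..<k} ?l"
    unfolding leading_rank_def using A k by (intro outer_rank_product_le_left) auto
  moreover have "leading_rank n k A \<le> outer_rank {..<k} {..<k} ?u"
    unfolding leading_rank_def using A k by (intro outer_rank_product_le_right) auto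
  moreover have "outer_rank {..<k} {..<k} ?l + outer_rank {..<k} {..<k} ?u
      \<le> leading_rank k k A + card {..<k}"
    unfolding leading_rank_def using A k by (intro sylvester_outer_rank) auto
  ultimately show "leading_rank k n A + leading_rank n k A \<le> leading_rank k k A + (k - 0)" by simp
qed

section \<open>Correctness of the output\<close>

lemma residual_index:
  assumes "A \<in> carrier_mat n n" "i < n" "j < n"
  shows "A $$ (i, j) = residual n A m $$ (i, j)
    + (\<Sum>k<m. fst (next_column_row n (residual n A k)) $ i * snd (next_column_row n (residual n A k)) $ j)"
  using assms by (induction m) (auto simp: eliminate_index)

text \<open>Column \<open>q\<close> and row \<open>p\<close> inherit the zeros of the first
  \<open>s\<close> rows and columns; without a pivot both vectors are zero.\<close>

lemma next_column_row_zero: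
  assumes "A \<in> carrier_mat n n" "\<And>i j. \<lbrakk>i < n; j < n; min i j < s\<rbrakk> \<Longrightarrow> A $$ (i, j) = 0" "i < n" "i < s"
  shows "fst (next_column_row n A) $ i = 0" "snd (next_column_row n A) $ i = 0"
  using assms
  by (auto simp: next_column_row_def min_less_iff_disj dest: find_pivot_SomeD(1,2) split: option.split)

lemma next_column_row_carrier:
  assumes "A \<in> carrier_mat n n"
  shows "fst (next_column_row n A) \<in> carrier_vec n" "snd (next_column_row n A) \<in> carrier_vec n"
  using assms by (auto simp: next_column_row_def split: option.split)

lemma LU_algorithm_correct:
  assumes A: "A \<in> carrier_mat n n" and cond: "rank_condition n 0 A"
    and LU: "LU_algorithm n A = (L, U)"
  shows "is_LU_factorization n A L U"
proof -
  let ?R = "residual n A"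
  let ?c = "\<lambda>k. fst (next_column_row n (?R k))" and ?r = "\<lambda>k. snd (next_column_row n (?R k))"
  have condR: "rank_condition n s (?R s)" for s
    by (induction s) (auto simp: cond A rank_condition_eliminate)
  have R0: "?R s $$ (i, j) = 0" if "s \<le> n" "i < n" "j < n" "min i j < s" for s i j
    using rank_condition_zero[OF condR that(1) order.refl that(2-4)] .
  \<comment> \<open>These are the entries of \<open>L\<close> above and of \<open>U\<close> below
    the diagonal.\<close>
  have c0: "?c s $ i = 0" and r0: "?r s $ i = 0" if "s < n" "i < s" for s i
    using next_column_row_zero[of "?R s" n s i] R0[of s] A that by auto
  have carr: "?c k \<in> carrier_vec n" "?r k \<in> carrier_vec n" for k
    by (simp_all add: next_column_row_carrier A)
  have L: "L = mat_of_cols n (map ?c [0..<n])" and U: "U = mat_of_rows n (map ?r [0..<n])"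
    using LU by (auto simp: LU_algorithm_def)
  have dims: "L \<in> carrier_mat n n" "U \<in> carrier_mat n n"
    using L U by (auto simp: mat_of_cols_def mat_of_rows_def)
  have Lij: "L $$ (i, k) = ?c k $ i" and Uij: "U $$ (k, i) = ?r k $ i" if "i < n" "k < n" for i k
    using that by (auto simp: L U mat_of_cols_index mat_of_rows_index)
  have "lower_triangular L" "upper_triangular U"
    using dims c0 r0 by (auto simp: lower_triangular_def upper_triangular_def Lij Uij)
  moreover have "A = L * U"
  proof (rule eq_matI)
    fix i j assume "i < dim_row (L * U)" "j < dim_col (L * U)"
    then have ij: "i < n" "j < n" using dims by auto
    \<comment> \<open>The steps telescope, and the residual after \<open>n\<close> steps is zero by
      \<open>R0\<close> at \<open>s = n\<close>.\<close>
    have "A $$ (i, j) = (\<Sum>k<n. ?c k $ i * ?r k $ j)"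
      using residual_index[OF A ij, of n] R0[of n i j] ij by simp
    also have "\<dots> = (L * U) $$ (i, j)"
      using dims ij by (simp add: scalar_prod_def Lij Uij atLeast0LessThan)
    finally show "A $$ (i, j) = (L * U) $$ (i, j)" .
  qed (use A dims in auto)
  ultimately show ?thesis using dims by (simp add: is_LU_factorization_def)
qed

theorem theorem2:
  fixes A :: "'a::field mat" and n :: nat
  assumes "n \<ge> 1" and "A \<in> carrier_mat n n"
  shows "has_LU_factorization n A \<longleftrightarrow>
    (case LU_algorithm n A of (L, U) \<Rightarrow> is_LU_factorization n A L U)"
  using LU_algorithm_correct[OF assms(2) rank_condition_LU]
  by (fastforce simp: has_LU_factorization_def split: prod.splits)

end
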